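(* Suppose the compactness, ergodicity and kernel-continuity conditions listed in the context hold. Let $f:\mathcal W\to\mathbb R$ be Borel measurable with $|f|\le U_1$. Then there is a positive constant $C$ such that, for all $k\ge1$, $$\Bigl|\mathbb E[f(W_k)\mid\mathcal F_0]-(P_{\theta_0}^kf)(W_0)\Bigr|\le C\sum_{s=1}^{k-1}\rho^{\,k-s-1}\,\mathbb E\bigl[U_1(W_s)\|\theta_s-\theta_0\|\,\bigm|\,\mathcal F_0\bigr].$$
   Context: Setting. $\|\cdot\|$ is the Euclidean norm. $\Theta\subseteq\mathbb R^d$, and $\Pi_\Theta$ is Euclidean projection onto $\Theta$. $\mathcal W$ is a Borel subset of a Euclidean space, $F:\Theta\times\mathcal W\to\mathbb R^d$ is jointly Borel measurable, and $\{P_\theta:\theta\in\Theta\}$ is a family of Markov transition kernels on $\mathcal W$ with $(\theta,w)\mapsto P_\theta(w,E)$ Borel measurable for each Borel $E\subseteq\mathcal W$. Write $(P_\theta f)(w):=\int_{\mathcal W}f(y)P_\theta(w,dy)$, $P_\theta^k$ for the $k$-step kernel, and $U_p(w):=1+\|w\|^p$ for $p\in\{1,2\}$. On a probability space, $(\theta_0,W_0)$ is a $\Theta\times\mathcal W$-valued random element, and $\theta_{k+1}=\Pi_\Theta(\theta_k+\alpha_kF(\theta_k,W_k))$ for $k\ge0$, with step sizes $\alpha_k$. With $\mathcal F_k:=\sigma(\theta_0,W_0,\dots,\theta_k,W_k)$, $\{W_k\}$ is the adaptive Markov chain: $\mathbb P(W_{k+1}\in E\mid\mathcal F_k)=P_{\theta_k}(W_k,E)$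 for all Borel $E$ and $k\ge0$. (In)equalities between random quantities hold almost surely; constants are deterministic and do not depend on running indices, sample paths or the realization of $(\theta_0,W_0)$. Conditions. - Compactness: $\Theta$ is nonempty, compact and convex. - Ergodicity: (i) each $P_\theta$ is irreducible and aperiodic (as a general-state-space chain); there are a positive integer $N$, a nonempty Borel set $\mathcal W_0\subseteq\mathcal W$, $\epsilon_0>0$ and a probability measure $\varphi$ on $\mathcal W$ with $P_\theta^N(w,E)\ge\epsilon_0\varphi(E)$ for all $\theta\in\Theta$, $w\in\mathcal W_0$ and Borel $E$; and there are constants $0\le\lambda<1$, $b\ge0$ with $(P_\theta U_2)(w)\le\lambda U_2(w)+b\,\mathbb I_{\mathcal W_0}(w)$ for all $\theta\in\Theta$, $w\in\mathcal W$. (ii) $\mathbb E[U_2(W_0)]<\infty$. - Kernel continuity: there is $L_P>0$ with $|(P_\theta f)(w)-(P_{\theta'}f)(w)|\le L_PU_1(w)\|\theta-\theta'\|$ for all $\theta,\theta'\in\Theta$, $w\in\mathcal W$ and Borel $f:\mathcal W\to\mathbb R$ with $|f|\le U_1$. Under these conditions each $P_\theta$ has a unique stationary distribution $\nu_\theta$, and $\rho\in(0,1)$ denotes a fixed constant, independent of $\theta$, for which there is a finite constant $C_0$ with $|(P_\theta^kf)(w)-\nu_\theta(f)|\le C_0\rho^kU_1(w)$ for all $\theta\in\Theta$, $w\in\mathcal W$, $k\ge0$ and Borel $f$ with $|f|\le U_1$ (such $\rho$ and $C_0$ exist under these conditions). *)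

theory Defs
  imports "HOL-Probability.Probability"
begin

definition U :: "nat \<Rightarrow> 'w::real_normed_vector \<Rightarrow> real" where
  "U p w = 1 + norm w ^ p"

primrec kernel_pow :: "'w measure \<Rightarrow> ('w \<Rightarrow> 'w measure) \<Rightarrow> nat \<Rightarrow> 'w \<Rightarrow> 'w measure" where
  "kernel_pow S K 0 w = return S w"
| "kernel_pow S K (Suc n) w = bind (kernel_pow S K n w) K"

text \<open>
  Irreducibility and aperiodicity of a Markov kernel \<open>K\<close> on a general state space \<open>S\<close> are taken
  in the sense of Meyn and Tweedie, \<open>Markov Chains and Stochastic Stability\<close>, Chapters 4 and 5:
  irreducibility with respect to some nonzero \<open>\<sigma>\<close>-finite measure, and period one, where the period
  is the largest length of a cycle that exhausts the space up to a null set of a maximal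
  irreducibility measure.
\<close>

definition irreducibility_measure :: "'w measure \<Rightarrow> ('w \<Rightarrow> 'w measure) \<Rightarrow> 'w measure \<Rightarrow> bool" where
  "irreducibility_measure S K \<psi> \<longleftrightarrow>
     sigma_finite_measure \<psi> \<and> sets \<psi> = sets S \<and> emeasure \<psi> (space S) > 0 \<and>
     (\<forall>E\<in>sets S. emeasure \<psi> E > 0 \<longrightarrow>
        (\<forall>w\<in>space S. \<exists>n\<ge>1. emeasure (kernel_pow S K n w) E > 0))"

definition irreducible_kernel :: "'w measure \<Rightarrow> ('w \<Rightarrow> 'w measure) \<Rightarrow> bool" where
  "irreducible_kernel S K \<longleftrightarrow> (\<exists>\<psi>. irreducibility_measure S K \<psi>)"

definition maximal_irreducibility_measure ::
  "'w measure \<Rightarrow> ('w \<Rightarrow> 'w measure) \<Rightarrow> 'w measure \<Rightarrow> bool" where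
  "maximal_irreducibility_measure S K \<psi> \<longleftrightarrow>
     irreducibility_measure S K \<psi> \<and>
     (\<forall>\<psi>'. irreducibility_measure S K \<psi>' \<longrightarrow> absolutely_continuous \<psi> \<psi>')"

definition kernel_cycle ::
  "'w measure \<Rightarrow> ('w \<Rightarrow> 'w measure) \<Rightarrow> 'w measure \<Rightarrow> nat \<Rightarrow> (nat \<Rightarrow> 'w set) \<Rightarrow> bool" where
  "kernel_cycle S K \<psi> m D \<longleftrightarrow>
     (\<forall>i<m. D i \<in> sets S) \<and> disjoint_family_on D {..<m} \<and>
     (\<forall>i<m. \<forall>w\<in>D i. emeasure (K w) (D (Suc i mod m)) = 1) \<and>
     space S - (\<Union>i<m. D i) \<in> null_sets \<psi>"

definition aperiodic_kernel :: "'w measure \<Rightarrow> ('w \<Rightarrow> 'w measure) \<Rightarrow> bool" where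
  "aperiodic_kernel S K \<longleftrightarrow>
     (\<forall>\<psi>. maximal_irreducibility_measure S K \<psi> \<longrightarrow> \<not> (\<exists>m\<ge>2. \<exists>D. kernel_cycle S K \<psi> m D))"

definition is_stationary :: "'w measure \<Rightarrow> ('w \<Rightarrow> 'w measure) \<Rightarrow> 'w measure \<Rightarrow> bool" where
  "is_stationary S K \<nu> \<longleftrightarrow> prob_space \<nu> \<and> sets \<nu> = sets S \<and> bind \<nu> K = \<nu>"

definition stationary_distribution :: "'w measure \<Rightarrow> ('w \<Rightarrow> 'w measure) \<Rightarrow> 'w measure" where
  "stationary_distribution S K = (THE \<nu>. is_stationary S K \<nu>)"

text \<open>
  The drift inequality is stated with the nonnegative integral, so that it entails
  \<open>P\<^sub>\<theta> U\<^sub>2 < \<infinity>\<close>; a Bochner integral would be \<open>0\<close> for a non-integrable \<open>U\<^sub>2\<close>.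
\<close>

definition uniform_ergodicity ::
  "'t set \<Rightarrow> 'w::real_normed_vector measure \<Rightarrow> ('t \<Rightarrow> 'w \<Rightarrow> 'w measure) \<Rightarrow> bool" where
  "uniform_ergodicity \<Theta> S P \<longleftrightarrow>
     (\<forall>\<theta>\<in>\<Theta>. irreducible_kernel S (P \<theta>) \<and> aperiodic_kernel S (P \<theta>)) \<and>
     (\<exists>(N::nat) W\<^sub>0 (\<epsilon>\<^sub>0::real) \<phi> (lam::real) (b::real).
        N > 0 \<and> W\<^sub>0 \<in> sets S \<and> W\<^sub>0 \<noteq> {} \<and> \<epsilon>\<^sub>0 > 0 \<and> prob_space \<phi> \<and> sets \<phi> = sets S \<and>
        (\<forall>\<theta>\<in>\<Theta>. \<forall>w\<in>W\<^sub>0. \<forall>E\<in>sets S.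
           measure (kernel_pow S (P \<theta>) N w) E \<ge> \<epsilon>\<^sub>0 * measure \<phi> E) \<and>
        0 \<le> lam \<and> lam < 1 \<and> b \<ge> 0 \<and>
        (\<forall>\<theta>\<in>\<Theta>. \<forall>w\<in>space S.
           (\<integral>\<^sup>+y. ennreal (U 2 y) \<partial>P \<theta> w) \<le> ennreal (lam * U 2 w + b * indicator W\<^sub>0 w)))"

definition kernel_continuity ::
  "'t::real_normed_vector set \<Rightarrow> 'w::real_normed_vector measure \<Rightarrow> ('t \<Rightarrow> 'w \<Rightarrow> 'w measure) \<Rightarrow> bool"
where
  "kernel_continuity \<Theta> S P \<longleftrightarrow>
     (\<exists>L>0. \<forall>\<theta>\<in>\<Theta>. \<forall>\<theta>'\<in>\<Theta>. \<forall>w\<in>space S. \<forall>f\<in>borel_measurable S.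
        (\<forall>y\<in>space S. \<bar>f y\<bar> \<le> U 1 y) \<longrightarrow>
        \<bar>(\<integral>y. f y \<partial>P \<theta> w) - (\<integral>y. f y \<partial>P \<theta>' w)\<bar> \<le> L * U 1 w * norm (\<theta> - \<theta>'))"

definition ergodicity_rate ::
  "'t set \<Rightarrow> 'w::real_normed_vector measure \<Rightarrow> ('t \<Rightarrow> 'w \<Rightarrow> 'w measure) \<Rightarrow> real \<Rightarrow> bool" where
  "ergodicity_rate \<Theta> S P \<rho> \<longleftrightarrow>
     0 < \<rho> \<and> \<rho> < 1 \<and>
     (\<exists>C\<^sub>0::real. \<forall>\<theta>\<in>\<Theta>. \<forall>w\<in>space S. \<forall>k. \<forall>f\<in>borel_measurable S.
        (\<forall>y\<in>space S. \<bar>f y\<bar> \<le> U 1 y) \<longrightarrow>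
        \<bar>(\<integral>y. f y \<partial>kernel_pow S (P \<theta>) k w) - (\<integral>y. f y \<partial>stationary_distribution S (P \<theta>))\<bar>
          \<le> C\<^sub>0 * \<rho> ^ k * U 1 w)"

text \<open>\<open>\<sigma>(\<theta>\<^sub>0, W\<^sub>0, \<dots>, \<theta>\<^sub>k, W\<^sub>k)\<close>; only the sets of this measure are relevant.\<close>

definition history ::
  "'o measure \<Rightarrow> (nat \<Rightarrow> 'o \<Rightarrow> 't::topological_space) \<Rightarrow> (nat \<Rightarrow> 'o \<Rightarrow> 'w::topological_space)
     \<Rightarrow> nat \<Rightarrow> 'o measure" where
  "history M \<theta> W k = sigma (space M)
     ((\<Union>j\<le>k. {\<theta> j -` A \<inter> space M |A. A \<in> sets borel}) \<union>
      (\<Union>j\<le>k. {W j -` A \<inter> space M |A. A \<in> sets borel}))"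

text \<open>
  The recursion is only required almost surely, so measurability of every \<open>\<theta> k\<close> is listed explicitly
  (it would follow from that of \<open>\<theta> 0\<close> if the recursion held everywhere).
\<close>

definition adaptive_markov_chain ::
  "'o measure \<Rightarrow> 't::euclidean_space set \<Rightarrow> 'w::euclidean_space measure \<Rightarrow>
   ('t \<Rightarrow> 'w \<Rightarrow> 't) \<Rightarrow> ('t \<Rightarrow> 'w \<Rightarrow> 'w measure) \<Rightarrow> (nat \<Rightarrow> real) \<Rightarrow>
   (nat \<Rightarrow> 'o \<Rightarrow> 't) \<Rightarrow> (nat \<Rightarrow> 'o \<Rightarrow> 'w) \<Rightarrow> bool" where
  "adaptive_markov_chain M \<Theta> S F P \<alpha> \<theta> W \<longleftrightarrow>
     (\<forall>k. \<theta> k \<in> M \<rightarrow>\<^sub>M restrict_space borel \<Theta>) \<and>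
     (\<forall>k. W k \<in> M \<rightarrow>\<^sub>M S) \<and>
     (\<forall>k. AE \<omega> in M. \<theta> (Suc k) \<omega> = closest_point \<Theta> (\<theta> k \<omega> + \<alpha> k *\<^sub>R F (\<theta> k \<omega>) (W k \<omega>))) \<and>
     (\<forall>k. \<forall>E\<in>sets S. AE \<omega> in M.
        real_cond_exp M (history M \<theta> W k) (indicator (W (Suc k) -` E \<inter> space M)) \<omega>
          = measure (P (\<theta> k \<omega>) (W k \<omega>)) E)"

end

theory Submission
  imports Defs
begin

text \<open>
  The idea is to change the kernels of the adaptive chain into the frozen kernel \<open>P\<^sub>\<theta>\<^sub>0\<close> one
  transition at a time. Write \<open>g\<^sub>n(\<theta>, w)\<close> for the expectation of \<open>f\<close> after \<open>n\<close> steps of the chain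
  with constant parameter \<open>\<theta>\<close> started at \<open>w\<close>. Then \<open>f(W\<^sub>k) = g\<^sub>0(\<theta>\<^sub>0, W\<^sub>k)\<close>, the second
  quantity of the theorem is \<open>g\<^sub>k(\<theta>\<^sub>0, W\<^sub>0)\<close>, and their difference telescopes into the terms
  \<open>g\<^sub>n(\<theta>\<^sub>0, W\<^sub>s\<^sub>+\<^sub>1) - g\<^sub>n\<^sub>+\<^sub>1(\<theta>\<^sub>0, W\<^sub>s)\<close> with \<open>n = k - s - 1\<close>.

  Given the history up to time \<open>s\<close>, the first of the two has expectation
  \<open>(P\<^sub>\<theta>\<^sub>s g\<^sub>n(\<theta>\<^sub>0, \<cdot>))(W\<^sub>s)\<close>, because \<open>\<theta>\<^sub>0\<close> is known and only \<open>W\<^sub>s\<^sub>+\<^sub>1\<close> is random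
  (\<open>real_cond_exp_freezing\<close>), whereas the second equals \<open>(P\<^sub>\<theta>\<^sub>0 g\<^sub>n(\<theta>\<^sub>0, \<cdot>))(W\<^sub>s)\<close>. So one
  transition is compared under two parameters. Neither side notices if the constant
  \<open>\<nu>\<^sub>\<theta>\<^sub>0(f)\<close> is subtracted from \<open>g\<^sub>n(\<theta>\<^sub>0, \<cdot>)\<close>, after which geometric ergodicity bounds the
  integrand by \<open>C\<^sub>0 \<rho>\<^sup>n U\<^sub>1\<close> and kernel continuity bounds the difference by
  \<open>C\<^sub>0 L \<rho>\<^sup>n U\<^sub>1(W\<^sub>s) \<parallel>\<theta>\<^sub>s - \<theta>\<^sub>0\<parallel>\<close> (\<open>evolve_perturbation\<close>). The term with
  \<open>s = 0\<close> vanishes. Taking conditional expectations given the initial data and summing yields the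
  claim with \<open>C = C\<^sub>0 L\<close>.

  The remaining work is integrability: \<open>f\<close> is unbounded, and the drift condition provides the second
  moments of the chain and of the kernel powers that dominate everything in sight.
\<close>

section \<open>Integration against kernels and the freezing lemma\<close>

text \<open>
  Disintegration of an integrable, possibly unbounded, function: the formula for nonnegative
  functions applies to the positive and to the negative part, whose integrals over almost every
  fibre \<open>K x\<close> are finite. The functions of interest below are only bounded by \<open>U 1\<close>, so a formula for bounded
  functions would not suffice.
\<close>
lemma bind_integral:
  fixes f :: "'b \<Rightarrow> real"
  assumes K: "K \<in> M \<rightarrow>\<^sub>M subprob_algebra N" and M: "space M \<noteq> {}"
    and f: "integrable (bind M K) f"
  shows integrable_bind: "integrable M (\<lambda>x. \<integral>y. f y \<partial>K x)"
    and integral_bind_integrable: "(\<integral>y. f y \<partial>bind M K) = (\<integral>x. \<integral>y. f y \<partial>K x \<partial>M)"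
proof -
  have sets_bind: "sets (bind M K) = sets N"
    by (rule sets_bind_measurable[OF K M])
  have fN[measurable]: "f \<in> borel_measurable N"
    using borel_measurable_integrable[OF f] by (simp cong: measurable_cong_sets add: sets_bind)
  note [measurable] = K
  have split: "(\<integral>\<^sup>+y. g y \<partial>bind M K) = (\<integral>\<^sup>+x. \<integral>\<^sup>+y. g y \<partial>K x \<partial>M)"
    if "g \<in> borel_measurable N" for g
    using that K by (rule nn_integral_bind)
  have fin: "(\<integral>\<^sup>+x. \<integral>\<^sup>+y. ennreal \<bar>f y\<bar> \<partial>K x \<partial>M) < \<infinity>"
    using f by (subst split[symmetric]) (auto simp: integrable_iff_bounded)
  have fibres: "AE x in M. integrable (K x) f"
  proof -
    have "AE x in M. (\<integral>\<^sup>+y. ennreal \<bar>f y\<bar> \<partial>K x) \<noteq> \<infinity>"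
      using fin by (intro nn_integral_PInf_AE) auto
    then show ?thesis
    proof (rule AE_mp, intro AE_I2 impI)
      fix x assume "x \<in> space M" "(\<integral>\<^sup>+y. ennreal \<bar>f y\<bar> \<partial>K x) \<noteq> \<infinity>"
      moreover from \<open>x \<in> space M\<close> have "sets (K x) = sets N"
        by (rule sets_kernel[OF K])
      ultimately show "integrable (K x) f"
        by (auto simp: integrable_iff_bounded top.not_eq_extremum cong: measurable_cong_sets)
    qed
  qed
  have meas[measurable]: "(\<lambda>x. \<integral>y. f y \<partial>K x) \<in> borel_measurable M"
    by measurable
  show int: "integrable M (\<lambda>x. \<integral>y. f y \<partial>K x)"
  proof (rule integrableI_bounded)
    have "(\<integral>\<^sup>+x. ennreal (norm (\<integral>y. f y \<partial>K x)) \<partial>M) \<le> (\<integral>\<^sup>+x. \<integral>\<^sup>+y. ennreal \<bar>f y\<bar> \<partial>K x \<partial>M)"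
    proof (rule nn_integral_mono_AE)
      show "AE x in M. ennreal (norm (\<integral>y. f y \<partial>K x)) \<le> (\<integral>\<^sup>+y. ennreal \<bar>f y\<bar> \<partial>K x)"
        using fibres
      proof eventually_elim
        fix x assume "integrable (K x) f"
        then show "ennreal (norm (\<integral>y. f y \<partial>K x)) \<le> (\<integral>\<^sup>+y. ennreal \<bar>f y\<bar> \<partial>K x)"
          using integral_norm_bound_ennreal[of "K x" f] by simp
      qed
    qed
    with fin show "(\<integral>\<^sup>+x. ennreal (norm (\<integral>y. f y \<partial>K x)) \<partial>M) < \<infinity>" by (rule order.strict_trans1[rotated])
  qed measurable
  have part: "integrable M (\<lambda>x. enn2real (\<integral>\<^sup>+y. ennreal (g y) \<partial>K x)) \<and>
      enn2real (\<integral>\<^sup>+y. ennreal (g y) \<partial>bind M K) = (\<integral>x. enn2real (\<integral>\<^sup>+y. ennreal (g y) \<partial>K x) \<partial>M)"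
    if g[measurable]: "g \<in> borel_measurable N" and le: "\<And>y. g y \<le> \<bar>f y\<bar>" for g :: "'b \<Rightarrow> real"
  proof -
    have "(\<integral>\<^sup>+x. \<integral>\<^sup>+y. ennreal (g y) \<partial>K x \<partial>M) \<le> (\<integral>\<^sup>+x. \<integral>\<^sup>+y. ennreal \<bar>f y\<bar> \<partial>K x \<partial>M)"
      by (intro nn_integral_mono ennreal_leI le)
    then have fin': "(\<integral>\<^sup>+x. \<integral>\<^sup>+y. ennreal (g y) \<partial>K x \<partial>M) < \<infinity>"
      using fin by (rule order.strict_trans1)
    have ae: "AE x in M. ennreal (enn2real (\<integral>\<^sup>+y. ennreal (g y) \<partial>K x)) = (\<integral>\<^sup>+y. ennreal (g y) \<partial>K x)"
    proof -
      have "AE x in M. (\<integral>\<^sup>+y. ennreal (g y) \<partial>K x) \<noteq> \<infinity>"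
        using fin' by (intro nn_integral_PInf_AE) auto
      then show ?thesis by eventually_elim (simp add: top.not_eq_extremum)
    qed
    have eq: "(\<integral>\<^sup>+x. ennreal (enn2real (\<integral>\<^sup>+y. ennreal (g y) \<partial>K x)) \<partial>M)
        = (\<integral>\<^sup>+x. \<integral>\<^sup>+y. ennreal (g y) \<partial>K x \<partial>M)"
      using ae by (rule nn_integral_cong_AE)
    have "integrable M (\<lambda>x. enn2real (\<integral>\<^sup>+y. ennreal (g y) \<partial>K x))"
      using eq fin' by (intro integrableI_nonneg) auto
    moreover have "(\<integral>x. enn2real (\<integral>\<^sup>+y. ennreal (g y) \<partial>K x) \<partial>M)
        = enn2real (\<integral>\<^sup>+x. \<integral>\<^sup>+y. ennreal (g y) \<partial>K x \<partial>M)"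
      by (subst integral_eq_nn_integral) (auto simp: eq)
    ultimately show ?thesis
      by (simp add: split)
  qed
  have "(\<integral>y. f y \<partial>bind M K) = enn2real (\<integral>\<^sup>+y. ennreal (f y) \<partial>bind M K)
      - enn2real (\<integral>\<^sup>+y. ennreal (- f y) \<partial>bind M K)"
    by (rule real_lebesgue_integral_def[OF f])
  also have "\<dots> = (\<integral>x. enn2real (\<integral>\<^sup>+y. ennreal (f y) \<partial>K x)
      - enn2real (\<integral>\<^sup>+y. ennreal (- f y) \<partial>K x) \<partial>M)"
    using part[of f] part[of "\<lambda>y. - f y"] by (subst Bochner_Integration.integral_diff) auto
  also have "\<dots> = (\<integral>x. \<integral>y. f y \<partial>K x \<partial>M)"
    using fibres by (intro integral_cong_AE) (auto simp: real_lebesgue_integral_def)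
  finally show "(\<integral>y. f y \<partial>bind M K) = (\<integral>x. \<integral>y. f y \<partial>K x \<partial>M)" .
qed

text \<open>
  Pushing \<open>Q \<omega>\<close> forward along \<open>Pair \<omega>\<close> moves the dependence of the integrand on \<open>\<omega>\<close> into the
  measure; the integrand is then one fixed function on the product space.
\<close>
lemma borel_measurable_integral_kernel:
  fixes h :: "'a \<Rightarrow> 'b \<Rightarrow> real"
  assumes Q: "Q \<in> G \<rightarrow>\<^sub>M subprob_algebra S" and h: "case_prod h \<in> borel_measurable (G \<Otimes>\<^sub>M S)"
  shows "(\<lambda>\<omega>. \<integral>y. h \<omega> y \<partial>Q \<omega>) \<in> borel_measurable G"
proof (rule measurable_cong[THEN iffD1])
  show "(\<lambda>\<omega>. \<integral>z. case_prod h z \<partial>distr (Q \<omega>) (G \<Otimes>\<^sub>M S) (Pair \<omega>)) \<in> borel_measurable G"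
  proof (rule measurable_compose[OF _ integral_measurable_subprob_algebra[OF h]])
    show "(\<lambda>\<omega>. distr (Q \<omega>) (G \<Otimes>\<^sub>M S) (Pair \<omega>)) \<in> G \<rightarrow>\<^sub>M subprob_algebra (G \<Otimes>\<^sub>M S)"
      by (rule measurable_distr2[OF _ Q]) simp
  qed
next
  fix \<omega> assume "\<omega> \<in> space G"
  then show "(\<integral>z. case_prod h z \<partial>distr (Q \<omega>) (G \<Otimes>\<^sub>M S) (Pair \<omega>)) = (\<integral>y. h \<omega> y \<partial>Q \<omega>)"
    using h sets_kernel[OF Q, of \<omega>] by (subst integral_distr) (auto cong: measurable_cong_sets)
qed

lemma measurable_distr_Pair:
  assumes sub: "subalgebra M G" and Q[measurable]: "Q \<in> G \<rightarrow>\<^sub>M prob_algebra S"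
  shows "(\<lambda>\<omega>. distr (Q \<omega>) (G \<Otimes>\<^sub>M S) (Pair \<omega>)) \<in> M \<rightarrow>\<^sub>M prob_algebra (G \<Otimes>\<^sub>M S)"
  by (rule measurable_from_subalg[OF sub]) measurable

text \<open>
  The hypothesis on the conditional probabilities only concerns one event at a time, with an
  exceptional null set that depends on the event. Integrated over a set of \<open>G\<close> it says that the law of
  \<open>(\<omega>, X \<omega>)\<close> and the mixture of the kernels \<open>Q\<close> agree on rectangles; these form a generator of
  \<open>G \<Otimes>\<^sub>M S\<close> stable under intersection, so the two measures are equal. All null sets are thereby
  handled at once.
\<close>
lemma joint_law_of_conditional_kernel:
  assumes "prob_space M" and sub: "subalgebra M G"
    and X[measurable]: "X \<in> M \<rightarrow>\<^sub>M S" and Q[measurable]: "Q \<in> G \<rightarrow>\<^sub>M prob_algebra S"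
    and cond: "\<And>E. E \<in> sets S \<Longrightarrow>
      AE \<omega> in M. real_cond_exp M G (indicator (X -` E \<inter> space M)) \<omega> = measure (Q \<omega>) E"
  shows "distr M (G \<Otimes>\<^sub>M S) (\<lambda>\<omega>. (\<omega>, X \<omega>)) = bind M (\<lambda>\<omega>. distr (Q \<omega>) (G \<Otimes>\<^sub>M S) (Pair \<omega>))"
      (is "?l = ?r")
proof -
  interpret prob_space M by fact
  interpret finite_measure_subalgebra M G by unfold_locales fact
  note from_sub = measurable_from_subalg[OF sub]
  have space_G: "space G = space M" and sets_G: "sets G \<subseteq> sets M"
    using sub by (auto simp: subalgebra_def)
  note Q' = measurable_prob_algebraD[OF measurable_distr_Pair[OF sub Q]]
  have Qsets: "sets (Q \<omega>) = sets S" and Qprob: "prob_space (Q \<omega>)" if "\<omega> \<in> space M" for \<omega>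
    using measurable_space[OF Q, of \<omega>] that by (auto simp: space_G space_prob_algebra)
  have id[measurable]: "(\<lambda>\<omega>. \<omega>) \<in> M \<rightarrow>\<^sub>M G" by (rule from_sub) simp
  have QM[measurable]: "Q \<in> M \<rightarrow>\<^sub>M subprob_algebra S" by (intro measurable_prob_algebraD from_sub Q)
  have sets_r: "sets ?r = sets (G \<Otimes>\<^sub>M S)"
    by (rule sets_bind_measurable[OF Q' not_empty])
  let ?E = "{a \<times> b | a b. a \<in> sets G \<and> b \<in> sets S}"
  show "?l = ?r"
  proof (rule measure_eqI_generator_eq[OF Int_stable_pair_measure_generator[of G S]])
    show "?E \<subseteq> Pow (space G \<times> space S)"
      using sets.space_closed[of G] sets.space_closed[of S] by auto
    show "sets ?l = sigma_sets (space G \<times> space S) ?E"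
      by (simp add: sets_pair_measure)
    show "sets ?r = sigma_sets (space G \<times> space S) ?E"
      unfolding sets_r by (simp add: sets_pair_measure)
    show "range (\<lambda>_. space G \<times> space S) \<subseteq> ?E" "(\<Union>_::nat. space G \<times> space S) = space G \<times> space S"
      by auto
    show "emeasure ?l (space G \<times> space S) \<noteq> \<infinity>" for i :: nat
      by (subst emeasure_distr) (auto simp: emeasure_eq_measure)
  next
    fix Z assume "Z \<in> ?E"
    then obtain A B where Z: "Z = A \<times> B" and A[measurable]: "A \<in> sets G" and B[measurable]: "B \<in> sets S"
      by auto
    have AM[measurable]: "A \<in> sets M" using A sets_G by auto
    have XB[measurable]: "X -` B \<inter> space M \<in> sets M" by measurable
    have "emeasure ?r Z = (\<integral>\<^sup>+\<omega>. emeasure (distr (Q \<omega>) (G \<Otimes>\<^sub>M S) (Pair \<omega>)) Z \<partial>M)"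
      unfolding Z by (rule emeasure_bind[OF not_empty Q']) simp
    also have "\<dots> = (\<integral>\<^sup>+\<omega>. ennreal (indicator A \<omega> * measure (Q \<omega>) B) \<partial>M)"
    proof (rule nn_integral_cong)
      fix \<omega> assume \<omega>: "\<omega> \<in> space M"
      interpret Q: prob_space "Q \<omega>" by (rule Qprob[OF \<omega>])
      have "Pair \<omega> \<in> Q \<omega> \<rightarrow>\<^sub>M G \<Otimes>\<^sub>M S"
        using \<omega> Qsets[OF \<omega>] by (auto simp: space_G cong: measurable_cong_sets)
      moreover have "Pair \<omega> -` (A \<times> B) \<inter> space (Q \<omega>) = (if \<omega> \<in> A then B else {})"
        using sets.sets_into_space[OF B] sets_eq_imp_space_eq[OF Qsets[OF \<omega>]] by auto
      ultimately show "emeasure (distr (Q \<omega>) (G \<Otimes>\<^sub>M S) (Pair \<omega>)) Z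
          = ennreal (indicator A \<omega> * measure (Q \<omega>) B)"
        unfolding Z by (subst emeasure_distr) (auto simp: Q.emeasure_eq_measure)
    qed
    also have "\<dots> = ennreal (\<integral>\<omega>. indicator A \<omega> * measure (Q \<omega>) B \<partial>M)"
    proof (rule nn_integral_eq_integral)
      show "integrable M (\<lambda>\<omega>. indicator A \<omega> * measure (Q \<omega>) B)"
        by (intro integrable_const_bound[of _ 1])
           (auto intro!: mult_le_one prob_space.prob_le_1 Qprob split: split_indicator)
    qed auto
    also have "(\<integral>\<omega>. indicator A \<omega> * measure (Q \<omega>) B \<partial>M)
        = (\<integral>\<omega>\<in>A. real_cond_exp M G (indicator (X -` B \<inter> space M)) \<omega> \<partial>M)"
      unfolding set_lebesgue_integral_def using cond[OF B]
      by (intro integral_cong_AE) (auto intro: borel_measurable_cond_exp2)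
    also have "\<dots> = (\<integral>\<omega>\<in>A. indicator (X -` B \<inter> space M) \<omega> \<partial>M)"
      by (intro real_cond_exp_intA[symmetric] A) (auto simp: emeasure_eq_measure)
    also have "\<dots> = measure M (A \<inter> (X -` B \<inter> space M))"
      unfolding set_lebesgue_integral_def
      by (simp add: indicator_inter_arith[symmetric] Int_assoc)
    also have "ennreal \<dots> = emeasure ?l Z"
      unfolding Z using sets.sets_into_space[OF AM]
      by (subst emeasure_distr) (auto simp: emeasure_eq_measure intro!: arg_cong[where f="measure M"])
    finally show "emeasure ?l Z = emeasure ?r Z" by simp
  qed
qed

lemma nn_integral_freezing:
  assumes "prob_space M" and sub: "subalgebra M G"
    and X[measurable]: "X \<in> M \<rightarrow>\<^sub>M S" and Q[measurable]: "Q \<in> G \<rightarrow>\<^sub>M prob_algebra S"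
    and cond: "\<And>E. E \<in> sets S \<Longrightarrow>
      AE \<omega> in M. real_cond_exp M G (indicator (X -` E \<inter> space M)) \<omega> = measure (Q \<omega>) E"
    and h[measurable]: "h \<in> borel_measurable S"
  shows "(\<integral>\<^sup>+\<omega>. h (X \<omega>) \<partial>M) = (\<integral>\<^sup>+\<omega>. \<integral>\<^sup>+y. h y \<partial>Q \<omega> \<partial>M)"
proof -
  note kernel = measurable_prob_algebraD[OF measurable_distr_Pair[OF sub Q]]
  have law: "distr M (G \<Otimes>\<^sub>M S) (\<lambda>\<omega>. (\<omega>, X \<omega>))
      = bind M (\<lambda>\<omega>. distr (Q \<omega>) (G \<Otimes>\<^sub>M S) (Pair \<omega>))"
    by (rule joint_law_of_conditional_kernel) fact+
  note from_sub = measurable_from_subalg[OF sub]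
  have id[measurable]: "(\<lambda>\<omega>. \<omega>) \<in> M \<rightarrow>\<^sub>M G" by (rule from_sub) simp
  have "(\<integral>\<^sup>+\<omega>. h (X \<omega>) \<partial>M) = (\<integral>\<^sup>+z. h (snd z) \<partial>distr M (G \<Otimes>\<^sub>M S) (\<lambda>\<omega>. (\<omega>, X \<omega>)))"
    by (subst nn_integral_distr) auto
  also have "\<dots> = (\<integral>\<^sup>+\<omega>. \<integral>\<^sup>+z. h (snd z) \<partial>distr (Q \<omega>) (G \<Otimes>\<^sub>M S) (Pair \<omega>) \<partial>M)"
    unfolding law by (rule nn_integral_bind[OF _ kernel]) simp
  also have "\<dots> = (\<integral>\<^sup>+\<omega>. \<integral>\<^sup>+y. h y \<partial>Q \<omega> \<partial>M)"
  proof (rule nn_integral_cong)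
    fix \<omega> assume "\<omega> \<in> space M"
    then have "\<omega> \<in> space G" "sets (Q \<omega>) = sets S"
      using sub measurable_space[OF Q, of \<omega>] by (auto simp: subalgebra_def space_prob_algebra)
    then show "(\<integral>\<^sup>+z. h (snd z) \<partial>distr (Q \<omega>) (G \<Otimes>\<^sub>M S) (Pair \<omega>)) = (\<integral>\<^sup>+y. h y \<partial>Q \<omega>)"
      by (subst nn_integral_distr) (auto cong: measurable_cong_sets)
  qed
  finally show ?thesis .
qed

text \<open>
  Conditionally on \<open>G\<close>, the \<open>G\<close>-measurable argument of \<open>h\<close> may be held fixed while \<open>X\<close> is
  integrated out against its conditional law. This is the form in which the Markov property enters:
  the function evaluated at the next state depends on the random initial parameter.
\<close>
lemma real_cond_exp_freezing:
  fixes h :: "'o \<Rightarrow> 'w \<Rightarrow> real"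
  assumes "prob_space M" and sub: "subalgebra M G"
    and X[measurable]: "X \<in> M \<rightarrow>\<^sub>M S" and Q[measurable]: "Q \<in> G \<rightarrow>\<^sub>M prob_algebra S"
    and cond: "\<And>E. E \<in> sets S \<Longrightarrow>
      AE \<omega> in M. real_cond_exp M G (indicator (X -` E \<inter> space M)) \<omega> = measure (Q \<omega>) E"
    and h[measurable]: "case_prod h \<in> borel_measurable (G \<Otimes>\<^sub>M S)"
    and int: "integrable M (\<lambda>\<omega>. h \<omega> (X \<omega>))"
  shows "integrable M (\<lambda>\<omega>. \<integral>y. h \<omega> y \<partial>Q \<omega>)"
    and "AE \<omega> in M. real_cond_exp M G (\<lambda>\<omega>. h \<omega> (X \<omega>)) \<omega> = (\<integral>y. h \<omega> y \<partial>Q \<omega>)"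
proof -
  interpret prob_space M by fact
  interpret finite_measure_subalgebra M G by unfold_locales fact
  note kernel = measurable_prob_algebraD[OF measurable_distr_Pair[OF sub Q]]
  have law: "distr M (G \<Otimes>\<^sub>M S) (\<lambda>\<omega>. (\<omega>, X \<omega>))
      = bind M (\<lambda>\<omega>. distr (Q \<omega>) (G \<Otimes>\<^sub>M S) (Pair \<omega>))"
    by (rule joint_law_of_conditional_kernel) fact+
  note from_sub = measurable_from_subalg[OF sub]
  have id[measurable]: "(\<lambda>\<omega>. \<omega>) \<in> M \<rightarrow>\<^sub>M G" by (rule from_sub) simp
  have graph[measurable]: "(\<lambda>\<omega>. (\<omega>, X \<omega>)) \<in> M \<rightarrow>\<^sub>M G \<Otimes>\<^sub>M S" by measurable
  have fibre: "(\<integral>z. g (fst z) (snd z) \<partial>distr (Q \<omega>) (G \<Otimes>\<^sub>M S) (Pair \<omega>)) = (\<integral>y. g \<omega> y \<partial>Q \<omega>)"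
    if "case_prod g \<in> borel_measurable (G \<Otimes>\<^sub>M S)" "\<omega> \<in> space M" for g :: "'o \<Rightarrow> 'w \<Rightarrow> real" and \<omega>
  proof -
    from that(2) have "\<omega> \<in> space G" "sets (Q \<omega>) = sets S"
      using sub measurable_space[OF Q, of \<omega>] by (auto simp: subalgebra_def space_prob_algebra)
    then show ?thesis
      using that(1) by (subst integral_distr) (auto cong: measurable_cong_sets simp: split_beta')
  qed
  have disint: "integrable M (\<lambda>\<omega>. \<integral>y. g \<omega> y \<partial>Q \<omega>) \<and>
      (\<integral>\<omega>. g \<omega> (X \<omega>) \<partial>M) = (\<integral>\<omega>. \<integral>y. g \<omega> y \<partial>Q \<omega> \<partial>M)"
    if g[measurable]: "case_prod g \<in> borel_measurable (G \<Otimes>\<^sub>M S)" and ig: "integrable M (\<lambda>\<omega>. g \<omega> (X \<omega>))"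
    for g :: "'o \<Rightarrow> 'w \<Rightarrow> real"
  proof -
    have g': "(\<lambda>z. g (fst z) (snd z)) \<in> borel_measurable (G \<Otimes>\<^sub>M S)" using g by (simp add: split_beta')
    have i: "integrable (distr M (G \<Otimes>\<^sub>M S) (\<lambda>\<omega>. (\<omega>, X \<omega>))) (\<lambda>z. g (fst z) (snd z))"
      using ig by (subst integrable_distr_eq[OF graph g']) simp
    note b = bind_integral[OF kernel not_empty i[unfolded law]]
    have "integrable M (\<lambda>\<omega>. \<integral>y. g \<omega> y \<partial>Q \<omega>)"
      using b(1) by (subst (asm) Bochner_Integration.integrable_cong[OF refl fibre[OF g]])
    moreover have "(\<integral>\<omega>. g \<omega> (X \<omega>) \<partial>M) = (\<integral>z. g (fst z) (snd z) \<partial>distr M (G \<Otimes>\<^sub>M S) (\<lambda>\<omega>. (\<omega>, X \<omega>)))"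
      by (subst integral_distr[OF graph g']) simp
    ultimately show ?thesis
      unfolding law b(2) by (simp add: fibre[OF g] cong: Bochner_Integration.integral_cong)
  qed
  show "integrable M (\<lambda>\<omega>. \<integral>y. h \<omega> y \<partial>Q \<omega>)" using disint[OF h int] ..
  then show "AE \<omega> in M. real_cond_exp M G (\<lambda>\<omega>. h \<omega> (X \<omega>)) \<omega> = (\<integral>y. h \<omega> y \<partial>Q \<omega>)"
  proof (intro real_cond_exp_charact int)
    fix A assume A[measurable]: "A \<in> sets G"
    then have AM: "A \<in> sets M" using sub by (auto simp: subalgebra_def)
    have "(\<integral>\<omega>. indicator A \<omega> * h \<omega> (X \<omega>) \<partial>M) = (\<integral>\<omega>. \<integral>y. indicator A \<omega> * h \<omega> y \<partial>Q \<omega> \<partial>M)"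
      using integrable_mult_indicator[OF AM int]
      by (intro disint[THEN conjunct2]) auto
    then show "(\<integral>\<omega>\<in>A. h \<omega> (X \<omega>) \<partial>M) = (\<integral>\<omega>\<in>A. (\<integral>y. h \<omega> y \<partial>Q \<omega>) \<partial>M)"
      by (simp add: set_lebesgue_integral_def)
  next
    show "(\<lambda>\<omega>. \<integral>y. h \<omega> y \<partial>Q \<omega>) \<in> borel_measurable G"
      using measurable_prob_algebraD[OF Q] h by (rule borel_measurable_integral_kernel)
  qed
qed

section \<open>Kernels with a drift condition and their powers\<close>

text \<open>
  The drift bound lets the expectation of \<open>U\<^sub>2\<close> grow by at most \<open>b\<close> per step, so second moments
  stay finite after any number of steps.
\<close>
locale drifting_kernels =
  fixes \<Theta> :: "'t::euclidean_space set" and S :: "'w::euclidean_space measure"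
    and P :: "'t \<Rightarrow> 'w \<Rightarrow> 'w measure" and b :: real
  assumes kernel: "case_prod P \<in> restrict_space borel \<Theta> \<Otimes>\<^sub>M S \<rightarrow>\<^sub>M prob_algebra S"
    and U_measurable[measurable]: "U p \<in> borel_measurable S"
    and b_nonneg: "0 \<le> b"
    and drift: "\<And>t w. t \<in> \<Theta> \<Longrightarrow> w \<in> space S \<Longrightarrow>
      (\<integral>\<^sup>+y. ennreal (U 2 y) \<partial>P t w) \<le> ennreal (U 2 w + b)"
begin

abbreviation T :: "'t measure" where "T \<equiv> restrict_space borel \<Theta>"

lemma U1_le_U2: "U 1 w \<le> 2 * U 2 w"
proof -
  have "0 \<le> (norm w - 1)\<^sup>2" by simp
  moreover have "0 \<le> (norm w)\<^sup>2" by simp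
  ultimately have "norm w \<le> 1 + 2 * (norm w)\<^sup>2"
    unfolding power2_diff one_power2 mult_1_right by linarith
  then show ?thesis by (simp add: U_def)
qed

lemma U_ge_1: "1 \<le> U p w"
  by (simp add: U_def)

lemma U_nonneg: "0 \<le> U p w"
  by (simp add: U_def)

lemma kernel_at: "t \<in> \<Theta> \<Longrightarrow> P t \<in> S \<rightarrow>\<^sub>M prob_algebra S"
  using measurable_Pair2[OF kernel, of t] by (simp add: space_restrict_space)

lemma kernel_pow_measurable:
  "(\<lambda>(t, w). kernel_pow S (P t) n w) \<in> T \<Otimes>\<^sub>M S \<rightarrow>\<^sub>M prob_algebra S"
proof (induction n)
  case (Suc n)
  have "(\<lambda>(z, y). P (fst z) y) \<in> (T \<Otimes>\<^sub>M S) \<Otimes>\<^sub>M S \<rightarrow>\<^sub>M prob_algebra S"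
    using measurable_compose[of "\<lambda>(z, y). (fst z, y)" "(T \<Otimes>\<^sub>M S) \<Otimes>\<^sub>M S", OF _ kernel]
    by (simp add: split_beta')
  with Suc show ?case
    unfolding split_beta' kernel_pow.simps
    by (intro measurable_bind_prob_space2[where N=S]) (auto simp: split_beta')
qed simp

lemma kernel_pow_at: "t \<in> \<Theta> \<Longrightarrow> kernel_pow S (P t) n \<in> S \<rightarrow>\<^sub>M prob_algebra S"
  using measurable_Pair2[OF kernel_pow_measurable, of t] by (simp add: space_restrict_space)

text \<open>
  Powers are defined by appending a step at the end. Prepending one is what allows
  the telescoping below to compare a first step with parameter \<open>\<theta>\<^sub>s\<close> to one with \<open>\<theta>\<^sub>0\<close>.
\<close>
lemma kernel_pow_Suc_left:
  assumes t: "t \<in> \<Theta>" and w: "w \<in> space S"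
  shows "kernel_pow S (P t) (Suc n) w = bind (P t w) (kernel_pow S (P t) n)"
proof (induction n)
  case 0
  have "bind (P t w) (\<lambda>w. return S w) = P t w"
    using measurable_space[OF kernel_at[OF t] w] by (intro bind_return'') (auto simp: space_prob_algebra)
  then show ?case
    using bind_return[OF measurable_prob_algebraD[OF kernel_at[OF t]] w] by simp
next
  case (Suc n)
  have "kernel_pow S (P t) (Suc (Suc n)) w = bind (bind (P t w) (kernel_pow S (P t) n)) (P t)"
    using Suc by simp
  also have "\<dots> = bind (P t w) (\<lambda>y. bind (kernel_pow S (P t) n y) (P t))"
  proof (rule bind_assoc)
    have "sets (P t w) = sets S"
      using measurable_space[OF kernel_at[OF t] w] by (auto simp: space_prob_algebra)
    then show "kernel_pow S (P t) n \<in> P t w \<rightarrow>\<^sub>M subprob_algebra S"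
      using measurable_prob_algebraD[OF kernel_pow_at[OF t]] by (simp cong: measurable_cong_sets)
    show "P t \<in> S \<rightarrow>\<^sub>M subprob_algebra S" by (rule measurable_prob_algebraD[OF kernel_at[OF t]])
  qed
  finally show ?case by simp
qed

lemma kernel_pow_moment:
  assumes t: "t \<in> \<Theta>" and w: "w \<in> space S"
  shows "(\<integral>\<^sup>+y. ennreal (U 2 y) \<partial>kernel_pow S (P t) n w) \<le> ennreal (U 2 w + n * b)"
  using w
proof (induction n arbitrary: w)
  case 0
  then show ?case by (simp add: nn_integral_return)
next
  case (Suc n)
  have sets: "sets (P t w) = sets S" and "prob_space (P t w)"
    using measurable_space[OF kernel_at[OF t] Suc.prems] by (auto simp: space_prob_algebra)
  then interpret p: prob_space "P t w" by simp
  have "(\<integral>\<^sup>+y. ennreal (U 2 y) \<partial>kernel_pow S (P t) (Suc n) w)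
      = (\<integral>\<^sup>+z. \<integral>\<^sup>+y. ennreal (U 2 y) \<partial>kernel_pow S (P t) n z \<partial>P t w)"
    unfolding kernel_pow_Suc_left[OF t Suc.prems]
    using measurable_prob_algebraD[OF kernel_pow_at[OF t]] sets
    by (intro nn_integral_bind[where B=S]) (auto cong: measurable_cong_sets)
  also have "\<dots> \<le> (\<integral>\<^sup>+z. ennreal (U 2 z) + ennreal (n * b) \<partial>P t w)"
    using Suc.IH sets_eq_imp_space_eq[OF sets] b_nonneg
    by (intro nn_integral_mono) (auto simp: U_nonneg simp flip: ennreal_plus)
  also have "\<dots> = (\<integral>\<^sup>+z. ennreal (U 2 z) \<partial>P t w) + ennreal (n * b)"
    using sets by (subst nn_integral_add) (auto simp: p.emeasure_space_1 cong: measurable_cong_sets)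
  also have "\<dots> \<le> ennreal (U 2 w + b) + ennreal (n * b)"
    by (intro add_mono drift t Suc.prems order_refl)
  also have "\<dots> = ennreal (U 2 w + Suc n * b)"
    using b_nonneg U_nonneg[of 2 w]
    by (subst ennreal_plus[symmetric]) (auto simp: algebra_simps)
  finally show ?case .
qed

lemma integrable_of_moment:
  assumes m: "(\<integral>\<^sup>+y. ennreal (U 2 y) \<partial>N) < \<infinity>" and sets: "sets N = sets S"
    and g: "g \<in> borel_measurable S" and le: "\<And>y. y \<in> space S \<Longrightarrow> \<bar>g y\<bar> \<le> c * U 1 y"
  shows "integrable N (g :: 'w \<Rightarrow> real)"
proof (rule Bochner_Integration.integrable_bound)
  show "integrable N (\<lambda>y. \<bar>c\<bar> * (2 * U 2 y))"
    using m sets U_nonneg[of 2]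
    by (intro integrable_mult_right integrableI_nonneg) (auto cong: measurable_cong_sets)
  show "g \<in> borel_measurable N" using g sets by (simp cong: measurable_cong_sets)
  show "AE y in N. norm (g y) \<le> norm (\<bar>c\<bar> * (2 * U 2 y))"
  proof (rule AE_I2)
    fix y assume "y \<in> space N"
    then have "\<bar>g y\<bar> \<le> c * U 1 y" using le sets_eq_imp_space_eq[OF sets] by auto
    also have "\<dots> \<le> \<bar>c\<bar> * U 1 y"
      using U_nonneg[of 1 y] by (intro mult_right_mono) auto
    also have "\<dots> \<le> \<bar>c\<bar> * (2 * U 2 y)" by (intro mult_left_mono U1_le_U2) auto
    finally show "norm (g y) \<le> norm (\<bar>c\<bar> * (2 * U 2 y))" by simp
  qed
qed

lemma integrable_kernel_pow:
  assumes "t \<in> \<Theta>" "w \<in> space S" "g \<in> borel_measurable S" "\<And>y. y \<in> space S \<Longrightarrow> \<bar>g y\<bar> \<le> c * U 1 y"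
  shows "integrable (kernel_pow S (P t) n w) (g :: 'w \<Rightarrow> real)"
  using kernel_pow_moment[OF assms(1,2), of n] measurable_space[OF kernel_pow_at[OF assms(1)] assms(2), of n]
  by (intro integrable_of_moment[where c=c] assms) (auto simp: space_prob_algebra intro: order.strict_trans1)

lemma integrable_kernel:
  assumes "t \<in> \<Theta>" "w \<in> space S" "g \<in> borel_measurable S" "\<And>y. y \<in> space S \<Longrightarrow> \<bar>g y\<bar> \<le> c * U 1 y"
  shows "integrable (P t w) (g :: 'w \<Rightarrow> real)"
  using drift[OF assms(1,2)] measurable_space[OF kernel_at[OF assms(1)] assms(2)]
  by (intro integrable_of_moment[where c=c] assms) (auto simp: space_prob_algebra intro: order.strict_trans1)

end

text \<open>
  The state \<open>w\<^sub>0\<close> is an arbitrary reference point; it turns the ergodicity estimate into a bound on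
  the stationary expectations that is uniform in the parameter.
\<close>
locale ergodic_kernels = drifting_kernels \<Theta> S P b
  for \<Theta> :: "'t::euclidean_space set" and S :: "'w::euclidean_space measure" and P b +
  fixes \<rho> C\<^sub>0 L :: real and w\<^sub>0
  assumes w\<^sub>0: "w\<^sub>0 \<in> space S"
    and rho_pos: "0 < \<rho>" and C0_pos: "0 < C\<^sub>0"
    and ergodic: "\<And>t w k g. t \<in> \<Theta> \<Longrightarrow> w \<in> space S \<Longrightarrow> g \<in> borel_measurable S \<Longrightarrow>
      (\<And>y. y \<in> space S \<Longrightarrow> \<bar>g y\<bar> \<le> U 1 y) \<Longrightarrow>
      \<bar>(\<integral>y. g y \<partial>kernel_pow S (P t) k w) - (\<integral>y. g y \<partial>stationary_distribution S (P t))\<bar>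
        \<le> C\<^sub>0 * \<rho> ^ k * U 1 w"
    and continuity: "\<And>t t' w g. t \<in> \<Theta> \<Longrightarrow> t' \<in> \<Theta> \<Longrightarrow> w \<in> space S \<Longrightarrow> g \<in> borel_measurable S \<Longrightarrow>
      (\<And>y. y \<in> space S \<Longrightarrow> \<bar>g y\<bar> \<le> U 1 y) \<Longrightarrow>
      \<bar>(\<integral>y. g y \<partial>P t w) - (\<integral>y. g y \<partial>P t' w)\<bar> \<le> L * U 1 w * norm (t - t')"
  fixes f :: "'w \<Rightarrow> real"
  assumes f_measurable[measurable]: "f \<in> borel_measurable S"
    and f_le: "\<And>y. y \<in> space S \<Longrightarrow> \<bar>f y\<bar> \<le> U 1 y"
begin

definition evolve :: "nat \<Rightarrow> 't \<Rightarrow> 'w \<Rightarrow> real" where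
  "evolve n t w = (\<integral>y. f y \<partial>kernel_pow S (P t) n w)"

lemma evolve_0: "w \<in> space S \<Longrightarrow> evolve 0 t w = f w"
  by (simp add: evolve_def integral_return)

lemma evolve_measurable[measurable]: "case_prod (evolve n) \<in> borel_measurable (T \<Otimes>\<^sub>M S)"
  unfolding evolve_def split_beta'
  by (rule borel_measurable_integral_kernel[where h="\<lambda>_. f" and S=S])
     (use measurable_prob_algebraD[OF kernel_pow_measurable[of n]] in \<open>auto simp: split_beta'\<close>)

lemma evolve_at_measurable: "t \<in> \<Theta> \<Longrightarrow> evolve n t \<in> borel_measurable S"
  using measurable_Pair2[OF evolve_measurable, of t] by (simp add: space_restrict_space)

lemma evolve_Suc:
  assumes t: "t \<in> \<Theta>" and w: "w \<in> space S"
  shows "evolve (Suc n) t w = (\<integral>y. evolve n t y \<partial>P t w)"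
proof -
  have sets: "sets (P t w) = sets S" and "prob_space (P t w)"
    using measurable_space[OF kernel_at[OF t] w] by (auto simp: space_prob_algebra)
  then interpret p: prob_space "P t w" by simp
  have "kernel_pow S (P t) n \<in> P t w \<rightarrow>\<^sub>M subprob_algebra S"
    using measurable_prob_algebraD[OF kernel_pow_at[OF t]] sets by (simp cong: measurable_cong_sets)
  moreover have "integrable (kernel_pow S (P t) (Suc n) w) f"
    using f_le by (intro integrable_kernel_pow[where c=1] t w) auto
  ultimately show ?thesis
    unfolding evolve_def kernel_pow_Suc_left[OF t w]
    by (intro integral_bind_integrable p.not_empty)
qed

lemma evolve_near_stationary:
  assumes "t \<in> \<Theta>" "w \<in> space S"
  shows "\<bar>evolve n t w - (\<integral>y. f y \<partial>stationary_distribution S (P t))\<bar> \<le> C\<^sub>0 * \<rho> ^ n * U 1 w"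
  unfolding evolve_def using f_le by (intro ergodic assms) auto

text \<open>
  Uniformity in \<open>t\<close> matters because the parameter will be random. The estimate for \<open>k = 0\<close> at the
  reference point bounds the stationary expectation of \<open>f\<close> by \<open>(C\<^sub>0 + 1) * U 1 w\<^sub>0\<close>, and the
  estimate for \<open>k = n\<close> then bounds \<open>evolve n t\<close>.
\<close>
lemma evolve_bounded: "\<exists>D\<ge>0. \<forall>t\<in>\<Theta>. \<forall>w\<in>space S. \<bar>evolve n t w\<bar> \<le> D * U 1 w"
proof (intro exI conjI ballI)
  define D where "D = C\<^sub>0 * \<rho> ^ n + (C\<^sub>0 + 1) * U 1 w\<^sub>0"
  show "0 \<le> D"
    using C0_pos rho_pos U_nonneg[of 1 w\<^sub>0] by (simp add: D_def)
  fix t w assume t: "t \<in> \<Theta>" and w: "w \<in> space S"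
  let ?c = "\<integral>y. f y \<partial>stationary_distribution S (P t)"
  have "\<bar>?c\<bar> \<le> (C\<^sub>0 + 1) * U 1 w\<^sub>0"
    using evolve_near_stationary[OF t w\<^sub>0, of 0] f_le[OF w\<^sub>0] by (simp add: evolve_0[OF w\<^sub>0] algebra_simps)
  moreover have "\<dots> \<le> (C\<^sub>0 + 1) * U 1 w\<^sub>0 * U 1 w"
    using mult_left_mono[OF U_ge_1[of 1 w], of "(C\<^sub>0 + 1) * U 1 w\<^sub>0"] C0_pos U_nonneg[of 1 w\<^sub>0]
    by simp
  ultimately show "\<bar>evolve n t w\<bar> \<le> D * U 1 w"
    using evolve_near_stationary[OF t w, of n] by (simp add: D_def algebra_simps)
qed

text \<open>
  Kernel continuity applied to \<open>evolve n t\<close> itself would give no decay in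
  \<open>n\<close>. Both kernels are probability measures, so subtracting the constant stationary expectation does
  not change the difference of the two integrals, and the centred function is at most
  \<open>C\<^sub>0 * \<rho> ^ n * U 1\<close>; rescaled by this factor it is admissible for kernel continuity.
\<close>
lemma evolve_perturbation:
  assumes t: "t \<in> \<Theta>" and t': "t' \<in> \<Theta>" and w: "w \<in> space S"
  shows "\<bar>(\<integral>y. evolve n t y \<partial>P t' w) - evolve (Suc n) t w\<bar> \<le> C\<^sub>0 * \<rho> ^ n * (L * U 1 w * norm (t' - t))"
proof -
  let ?c = "\<integral>y. f y \<partial>stationary_distribution S (P t)" and ?r = "C\<^sub>0 * \<rho> ^ n"
  define g where "g y = (evolve n t y - ?c) / ?r" for y
  have r: "0 < ?r" using C0_pos rho_pos by simp
  have [measurable]: "evolve n t \<in> borel_measurable S" by (rule evolve_at_measurable[OF t])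
  have g_meas: "g \<in> borel_measurable S" unfolding g_def by measurable
  have g_le: "\<bar>g y\<bar> \<le> U 1 y" if "y \<in> space S" for y
    using evolve_near_stationary[OF t that, of n] r
    by (simp add: g_def abs_divide field_simps del: abs_mult)
  have recover: "(\<integral>y. evolve n t y \<partial>P s w) = ?r * (\<integral>y. g y \<partial>P s w) + ?c" if s: "s \<in> \<Theta>" for s
  proof -
    interpret p: prob_space "P s w"
      using measurable_space[OF kernel_at[OF s] w] by (auto simp: space_prob_algebra)
    have "integrable (P s w) g"
      using g_le by (intro integrable_kernel[where c=1] s w g_meas) auto
    then have "?r * (\<integral>y. g y \<partial>P s w) + ?c = (\<integral>y. ?r * g y + ?c \<partial>P s w)"
      by (simp add: p.prob_space)
    also have "\<dots> = (\<integral>y. evolve n t y \<partial>P s w)"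
      using C0_pos rho_pos by (intro Bochner_Integration.integral_cong) (simp_all add: g_def)
    finally show ?thesis by simp
  qed
  have "(\<integral>y. evolve n t y \<partial>P t' w) - evolve (Suc n) t w = ?r * ((\<integral>y. g y \<partial>P t' w) - (\<integral>y. g y \<partial>P t w))"
    unfolding evolve_Suc[OF t w] recover[OF t] recover[OF t'] by (simp add: algebra_simps)
  then have "\<bar>(\<integral>y. evolve n t y \<partial>P t' w) - evolve (Suc n) t w\<bar>
      = ?r * \<bar>(\<integral>y. g y \<partial>P t' w) - (\<integral>y. g y \<partial>P t w)\<bar>"
    using C0_pos rho_pos by (simp add: abs_mult)
  also have "\<dots> \<le> ?r * (L * U 1 w * norm (t' - t))"
    using r g_le by (intro mult_left_mono continuity t t' w g_meas) auto
  finally show ?thesis .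
qed

end

section \<open>The adaptive chain\<close>

locale ergodic_adaptive_chain =
  ergodic_kernels \<Theta> S P b \<rho> C\<^sub>0 L w\<^sub>0 f + prob_space M
  for \<Theta> :: "'t::euclidean_space set" and S :: "'w::euclidean_space measure" and P b \<rho> C\<^sub>0 L w\<^sub>0 f
    and M :: "'o measure" +
  fixes \<W> :: "'w set" and \<theta> :: "nat \<Rightarrow> 'o \<Rightarrow> 't" and W :: "nat \<Rightarrow> 'o \<Rightarrow> 'w"
  assumes S_eq: "S = restrict_space borel \<W>"
    and bounded_\<Theta>: "bounded \<Theta>"
    and \<theta>_measurable[measurable]: "\<And>k. \<theta> k \<in> M \<rightarrow>\<^sub>M T"
    and W_measurable[measurable]: "\<And>k. W k \<in> M \<rightarrow>\<^sub>M S"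
    and transition: "\<And>k E. E \<in> sets S \<Longrightarrow> AE \<omega> in M.
        real_cond_exp M (history M \<theta> W k) (indicator (W (Suc k) -` E \<inter> space M)) \<omega>
          = measure (P (\<theta> k \<omega>) (W k \<omega>)) E"
    and initial_moment: "(\<integral>\<^sup>+\<omega>. ennreal (U 2 (W 0 \<omega>)) \<partial>M) < \<infinity>"
begin

abbreviation H :: "nat \<Rightarrow> 'o measure" where "H \<equiv> history M \<theta> W"

lemma \<theta>_in: "\<omega> \<in> space M \<Longrightarrow> \<theta> k \<omega> \<in> \<Theta>"
  using measurable_space[OF \<theta>_measurable] by (simp add: space_restrict_space)

lemma W_in: "\<omega> \<in> space M \<Longrightarrow> W k \<omega> \<in> space S"
  by (rule measurable_space[OF W_measurable])

lemma \<theta>_borel: "\<theta> k \<in> borel_measurable M"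
  using \<theta>_measurable[of k] by (simp add: measurable_restrict_space2_iff)

lemma W_borel: "W k \<in> borel_measurable M"
  using W_measurable[of k] by (simp add: S_eq measurable_restrict_space2_iff)

lemma history_generators:
  "(\<Union>j\<le>k. {\<theta> j -` A \<inter> space M |A. A \<in> sets borel}) \<union>
   (\<Union>j\<le>k. {W j -` A \<inter> space M |A. A \<in> sets borel}) \<subseteq> sets M"
  using measurable_sets[OF \<theta>_borel] measurable_sets[OF W_borel] by auto

lemma space_history: "space (H k) = space M"
  unfolding history_def using history_generators[of k] sets.space_closed[of M]
  by (intro space_measure_of) blast

lemma sets_history: "sets (H k) = sigma_sets (space M)
   ((\<Union>j\<le>k. {\<theta> j -` A \<inter> space M |A. A \<in> sets borel}) \<union>
    (\<Union>j\<le>k. {W j -` A \<inter> space M |A. A \<in> sets borel}))"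
  unfolding history_def using history_generators[of k] sets.space_closed[of M]
  by (intro sets_measure_of) blast

lemma subalgebra_history: "subalgebra M (H k)"
  unfolding subalgebra_def sets_history space_history
  using sets.sigma_sets_subset[OF history_generators] by simp

lemma subalgebra_history_mono: "j \<le> k \<Longrightarrow> subalgebra (H k) (H j)"
  unfolding subalgebra_def sets_history space_history
  by (intro conjI refl sigma_sets_subseteq Un_mono UN_mono) auto

lemma \<theta>_history: "j \<le> k \<Longrightarrow> \<theta> j \<in> H k \<rightarrow>\<^sub>M T"
proof (intro measurable_restrict_space2 measurableI)
  show "\<theta> j \<in> space (H k) \<rightarrow> \<Theta>" by (auto simp: space_history \<theta>_in)
  fix A :: "'t set" assume "j \<le> k" "A \<in> sets borel"
  then show "\<theta> j -` A \<inter> space (H k) \<in> sets (H k)"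
    unfolding space_history sets_history by (intro sigma_sets.Basic) auto
qed simp

lemma W_history: "j \<le> k \<Longrightarrow> W j \<in> H k \<rightarrow>\<^sub>M S"
  unfolding S_eq
proof (intro measurable_restrict_space2 measurableI)
  show "W j \<in> space (H k) \<rightarrow> \<W>"
    using W_in[of _ j] by (auto simp: space_history S_eq space_restrict_space)
  fix A :: "'w set" assume "j \<le> k" "A \<in> sets borel"
  then show "W j -` A \<inter> space (H k) \<in> sets (H k)"
    unfolding space_history sets_history by (intro sigma_sets.Basic) auto
qed simp

lemma transition_kernel_measurable: "(\<lambda>\<omega>. P (\<theta> k \<omega>) (W k \<omega>)) \<in> H k \<rightarrow>\<^sub>M prob_algebra S"
  using measurable_compose[OF measurable_Pair[OF \<theta>_history[of k k] W_history[of k k]] kernel] by simp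

text \<open>
  The drift inequality holds for every parameter value, hence also along the random parameters.
\<close>
lemma moment: "(\<integral>\<^sup>+\<omega>. ennreal (U 2 (W k \<omega>)) \<partial>M) < \<infinity>"
proof (induction k)
  case 0
  show ?case by (rule initial_moment)
next
  case (Suc k)
  have "(\<integral>\<^sup>+\<omega>. ennreal (U 2 (W (Suc k) \<omega>)) \<partial>M)
      = (\<integral>\<^sup>+\<omega>. \<integral>\<^sup>+y. ennreal (U 2 y) \<partial>P (\<theta> k \<omega>) (W k \<omega>) \<partial>M)"
    by (rule nn_integral_freezing[OF prob_space_axioms subalgebra_history W_measurable
          transition_kernel_measurable transition measurable_compose[OF U_measurable measurable_ennreal]])
  also have "\<dots> \<le> (\<integral>\<^sup>+\<omega>. ennreal (U 2 (W k \<omega>)) + ennreal b \<partial>M)"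
    using drift[OF \<theta>_in W_in] b_nonneg
    by (intro nn_integral_mono) (simp add: U_nonneg flip: ennreal_plus)
  also have "\<dots> = (\<integral>\<^sup>+\<omega>. ennreal (U 2 (W k \<omega>)) \<partial>M) + ennreal b"
    by (subst nn_integral_add) (auto simp: emeasure_space_1)
  also have "\<dots> < \<infinity>" using Suc by simp
  finally show ?case .
qed

lemma integrable_U1: "integrable M (\<lambda>\<omega>. U 1 (W k \<omega>))"
proof -
  have "integrable (distr M S (W k)) (U 1)"
    using moment[of k] U_nonneg[of 1]
    by (intro integrable_of_moment[where c=1]) (auto simp: nn_integral_distr)
  then show ?thesis by (subst (asm) integrable_distr_eq) auto
qed

lemma evolve_chain_measurable: "j \<le> k \<Longrightarrow> s \<le> k \<Longrightarrow> (\<lambda>\<omega>. evolve n (\<theta> j \<omega>) (W s \<omega>)) \<in> borel_measurable (H k)"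
  using measurable_compose[OF measurable_Pair[OF \<theta>_history[of j k] W_history[of s k]] evolve_measurable]
  by simp

lemma integrable_evolve: "integrable M (\<lambda>\<omega>. evolve n (\<theta> j \<omega>) (W s \<omega>))"
proof -
  obtain D where D: "0 \<le> D" "\<And>t w. t \<in> \<Theta> \<Longrightarrow> w \<in> space S \<Longrightarrow> \<bar>evolve n t w\<bar> \<le> D * U 1 w"
    using evolve_bounded[of n] by blast
  show ?thesis
  proof (rule Bochner_Integration.integrable_bound)
    show "integrable M (\<lambda>\<omega>. D * U 1 (W s \<omega>))" by (intro integrable_mult_right integrable_U1)
    show "(\<lambda>\<omega>. evolve n (\<theta> j \<omega>) (W s \<omega>)) \<in> borel_measurable M"
      using measurable_from_subalg[OF subalgebra_history evolve_chain_measurable[of j "max j s" s n]]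
      by simp
    show "AE \<omega> in M. norm (evolve n (\<theta> j \<omega>) (W s \<omega>)) \<le> norm (D * U 1 (W s \<omega>))"
    proof (rule AE_I2)
      fix \<omega> assume "\<omega> \<in> space M"
      then have "\<bar>evolve n (\<theta> j \<omega>) (W s \<omega>)\<bar> \<le> D * U 1 (W s \<omega>)" by (intro D \<theta>_in W_in)
      then show "norm (evolve n (\<theta> j \<omega>) (W s \<omega>)) \<le> norm (D * U 1 (W s \<omega>))" by simp
    qed
  qed
qed

lemma integrable_displacement: "integrable M (\<lambda>\<omega>. U 1 (W s \<omega>) * norm (\<theta> s \<omega> - \<theta> 0 \<omega>))"
proof -
  obtain B where B: "\<And>t. t \<in> \<Theta> \<Longrightarrow> norm t \<le> B"
    using bounded_\<Theta> by (auto simp: bounded_iff)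
  show ?thesis
  proof (rule Bochner_Integration.integrable_bound)
    show "integrable M (\<lambda>\<omega>. U 1 (W s \<omega>) * (2 * B))" by (intro integrable_mult_left integrable_U1)
    show "(\<lambda>\<omega>. U 1 (W s \<omega>) * norm (\<theta> s \<omega> - \<theta> 0 \<omega>)) \<in> borel_measurable M"
      using \<theta>_borel[measurable] by measurable
    show "AE \<omega> in M. norm (U 1 (W s \<omega>) * norm (\<theta> s \<omega> - \<theta> 0 \<omega>)) \<le> norm (U 1 (W s \<omega>) * (2 * B))"
    proof (rule AE_I2)
      fix \<omega> assume \<omega>: "\<omega> \<in> space M"
      have "norm (\<theta> s \<omega> - \<theta> 0 \<omega>) \<le> 2 * B"
        using norm_triangle_ineq4[of "\<theta> s \<omega>" "\<theta> 0 \<omega>"] B[OF \<theta>_in[OF \<omega>], of s] B[OF \<theta>_in[OF \<omega>], of 0]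
        by linarith
      moreover from this have "0 \<le> B" using norm_ge_zero[of "\<theta> s \<omega> - \<theta> 0 \<omega>"] by linarith
      ultimately show "norm (U 1 (W s \<omega>) * norm (\<theta> s \<omega> - \<theta> 0 \<omega>)) \<le> norm (U 1 (W s \<omega>) * (2 * B))"
        using U_nonneg[of 1 "W s \<omega>"] by (auto simp: abs_mult intro!: mult_left_mono)
    qed
  qed
qed

text \<open>
  Conditioning first on the history up to time \<open>s\<close> replaces \<open>evolve n (\<theta> 0) (W (Suc s))\<close> by its
  integral against \<open>P (\<theta> s) (W s)\<close>, the initial parameter being known at time \<open>s\<close>. This integral
  differs from \<open>evolve (Suc n) (\<theta> 0) (W s)\<close> only in the parameter of one transition.
\<close>
lemma one_step_error:
  "AE \<omega> in M.
    \<bar>real_cond_exp M (H 0) (\<lambda>\<omega>. evolve n (\<theta> 0 \<omega>) (W (Suc s) \<omega>)) \<omega>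
        - real_cond_exp M (H 0) (\<lambda>\<omega>. evolve (Suc n) (\<theta> 0 \<omega>) (W s \<omega>)) \<omega>\<bar>
      \<le> C\<^sub>0 * L * \<rho> ^ n *
          real_cond_exp M (H 0) (\<lambda>\<omega>. U 1 (W s \<omega>) * norm (\<theta> s \<omega> - \<theta> 0 \<omega>)) \<omega>"
proof -
  interpret H0: finite_measure_subalgebra M "H 0"
    by unfold_locales (rule subalgebra_history)
  interpret Hs: finite_measure_subalgebra M "H s"
    by unfold_locales (rule subalgebra_history)
  let ?c = "C\<^sub>0 * L * \<rho> ^ n"
  define Y where "Y = (\<lambda>\<omega>. evolve n (\<theta> 0 \<omega>) (W (Suc s) \<omega>))"
  define Y' where "Y' = (\<lambda>\<omega>. evolve (Suc n) (\<theta> 0 \<omega>) (W s \<omega>))"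
  define V where "V = (\<lambda>\<omega>. \<integral>y. evolve n (\<theta> 0 \<omega>) y \<partial>P (\<theta> s \<omega>) (W s \<omega>))"
  define Z where "Z = (\<lambda>\<omega>. U 1 (W s \<omega>) * norm (\<theta> s \<omega> - \<theta> 0 \<omega>))"
  have intY: "integrable M Y" and intY': "integrable M Y'" and intZ: "integrable M Z"
    unfolding Y_def Y'_def Z_def by (rule integrable_evolve integrable_displacement)+
  have "(\<lambda>(\<omega>, y). evolve n (\<theta> 0 \<omega>) y) \<in> borel_measurable (H s \<Otimes>\<^sub>M S)"
  proof -
    have [measurable]: "\<theta> 0 \<in> H s \<rightarrow>\<^sub>M T" by (rule \<theta>_history) simp
    have "(\<lambda>z. (\<theta> 0 (fst z), snd z)) \<in> H s \<Otimes>\<^sub>M S \<rightarrow>\<^sub>M T \<Otimes>\<^sub>M S" by measurable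
    from measurable_compose[OF this evolve_measurable] show ?thesis by (simp add: split_beta')
  qed
  note freeze = real_cond_exp_freezing[OF prob_space_axioms subalgebra_history W_measurable
      transition_kernel_measurable transition this integrable_evolve]
  have intV: "integrable M V" and condV: "AE \<omega> in M. real_cond_exp M (H s) Y \<omega> = V \<omega>"
    using freeze unfolding V_def Y_def by auto
  have bound: "\<bar>V \<omega> - Y' \<omega>\<bar> \<le> ?c * Z \<omega>" if "\<omega> \<in> space M" for \<omega>
    using evolve_perturbation[OF \<theta>_in[OF that, of 0] \<theta>_in[OF that, of s] W_in[OF that, of s], of n]
    by (simp add: V_def Y'_def Z_def algebra_simps)
  have "AE \<omega> in M. real_cond_exp M (H 0) (real_cond_exp M (H s) Y) \<omega> = real_cond_exp M (H 0) Y \<omega>"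
    by (rule H0.real_cond_exp_nested_subalg[OF subalgebra_history subalgebra_history_mono intY]) simp
  moreover have "AE \<omega> in M. real_cond_exp M (H 0) (real_cond_exp M (H s) Y) \<omega> = real_cond_exp M (H 0) V \<omega>"
    using condV intV by (intro H0.real_cond_exp_cong) auto
  moreover have "AE \<omega> in M. real_cond_exp M (H 0) (\<lambda>\<omega>. V \<omega> - Y' \<omega>) \<omega>
      = real_cond_exp M (H 0) V \<omega> - real_cond_exp M (H 0) Y' \<omega>"
    by (rule H0.real_cond_exp_diff[OF intV intY'])
  moreover have "AE \<omega> in M. real_cond_exp M (H 0) (\<lambda>\<omega>. V \<omega> - Y' \<omega>) \<omega>
      \<le> real_cond_exp M (H 0) (\<lambda>\<omega>. ?c * Z \<omega>) \<omega>"
    by (rule H0.real_cond_exp_mono)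
      (rule AE_I2, use bound in \<open>fastforce simp: abs_le_iff\<close>, auto intro: intV intY' intZ)
  moreover have "AE \<omega> in M. real_cond_exp M (H 0) (\<lambda>\<omega>. - ?c * Z \<omega>) \<omega>
      \<le> real_cond_exp M (H 0) (\<lambda>\<omega>. V \<omega> - Y' \<omega>) \<omega>"
    by (rule H0.real_cond_exp_mono)
      (rule AE_I2, use bound in \<open>fastforce simp: abs_le_iff\<close>, auto intro: intV intY' intZ)
  moreover have "AE \<omega> in M. real_cond_exp M (H 0) (\<lambda>\<omega>. ?c * Z \<omega>) \<omega> = ?c * real_cond_exp M (H 0) Z \<omega>"
    by (rule H0.real_cond_exp_cmult[OF intZ])
  moreover have "AE \<omega> in M. real_cond_exp M (H 0) (\<lambda>\<omega>. - ?c * Z \<omega>) \<omega> = - ?c * real_cond_exp M (H 0) Z \<omega>"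
    by (rule H0.real_cond_exp_cmult[OF intZ])
  ultimately have "AE \<omega> in M. \<bar>real_cond_exp M (H 0) Y \<omega> - real_cond_exp M (H 0) Y' \<omega>\<bar>
      \<le> ?c * real_cond_exp M (H 0) Z \<omega>"
    by eventually_elim auto
  then show ?thesis unfolding Y_def Y'_def Z_def .
qed

text \<open>
  The terms \<open>e s\<close> interpolate between the two quantities: \<open>e s\<close> follows the adaptive chain up to
  time \<open>s\<close> and then the chain with parameter frozen at \<open>\<theta>\<^sub>0\<close> for the remaining \<open>k - s\<close> steps.
\<close>
theorem conditional_expectation_error:
  assumes "1 \<le> k"
  shows "AE \<omega> in M.
    \<bar>real_cond_exp M (H 0) (\<lambda>\<omega>. f (W k \<omega>)) \<omega> - (\<integral>y. f y \<partial>kernel_pow S (P (\<theta> 0 \<omega>)) k (W 0 \<omega>))\<bar>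
      \<le> C\<^sub>0 * L * (\<Sum>s=1..k - 1. \<rho> ^ (k - s - 1) *
          real_cond_exp M (H 0) (\<lambda>\<omega>. U 1 (W s \<omega>) * norm (\<theta> s \<omega> - \<theta> 0 \<omega>)) \<omega>)"
proof -
  interpret H0: finite_measure_subalgebra M "H 0"
    by unfold_locales (rule subalgebra_history)
  define Z where "Z s \<omega> = real_cond_exp M (H 0) (\<lambda>\<omega>. U 1 (W s \<omega>) * norm (\<theta> s \<omega> - \<theta> 0 \<omega>)) \<omega>" for s \<omega>
  define e where "e s = real_cond_exp M (H 0) (\<lambda>\<omega>. evolve (k - s) (\<theta> 0 \<omega>) (W s \<omega>))" for s
  have "AE \<omega> in M. real_cond_exp M (H 0) (\<lambda>\<omega>. f (W k \<omega>)) \<omega> = e k \<omega>"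
    unfolding e_def
  proof (rule H0.real_cond_exp_cong)
    show "AE \<omega> in M. f (W k \<omega>) = evolve (k - k) (\<theta> 0 \<omega>) (W k \<omega>)"
      by (intro AE_I2) (simp add: evolve_0 W_in)
    show "(\<lambda>\<omega>. evolve (k - k) (\<theta> 0 \<omega>) (W k \<omega>)) \<in> borel_measurable M"
      using integrable_evolve by auto
  qed measurable
  moreover have "AE \<omega> in M. e 0 \<omega> = evolve k (\<theta> 0 \<omega>) (W 0 \<omega>)"
    unfolding e_def using H0.real_cond_exp_F_meas[OF integrable_evolve evolve_chain_measurable[of 0 0 0]]
    by simp
  \<comment> \<open>The first step already uses \<open>\<theta>\<^sub>0\<close>; this is why the sum starts at \<open>s = 1\<close>.\<close>
  moreover have "AE \<omega> in M. Z 0 \<omega> = 0"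
    unfolding Z_def using H0.real_cond_exp_F_meas[of "\<lambda>_. 0"] by simp
  moreover have "AE \<omega> in M. \<forall>s\<in>{..<k}. \<bar>e (Suc s) \<omega> - e s \<omega>\<bar> \<le> C\<^sub>0 * L * (\<rho> ^ (k - s - 1) * Z s \<omega>)"
  proof (rule AE_finite_allI)
    fix s assume "s \<in> {..<k}"
    then have "k - s = Suc (k - Suc s)" by auto
    then show "AE \<omega> in M. \<bar>e (Suc s) \<omega> - e s \<omega>\<bar> \<le> C\<^sub>0 * L * (\<rho> ^ (k - s - 1) * Z s \<omega>)"
      using one_step_error[of "k - Suc s" s] by (simp add: e_def Z_def mult.assoc)
  qed simp
  ultimately show ?thesis
  proof eventually_elim
    fix \<omega>
    assume last: "real_cond_exp M (H 0) (\<lambda>\<omega>. f (W k \<omega>)) \<omega> = e k \<omega>"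
      and first: "e 0 \<omega> = evolve k (\<theta> 0 \<omega>) (W 0 \<omega>)" and Z0: "Z 0 \<omega> = 0"
      and step: "\<forall>s\<in>{..<k}. \<bar>e (Suc s) \<omega> - e s \<omega>\<bar> \<le> C\<^sub>0 * L * (\<rho> ^ (k - s - 1) * Z s \<omega>)"
    have "\<bar>e k \<omega> - e 0 \<omega>\<bar> = \<bar>\<Sum>s<k. e (Suc s) \<omega> - e s \<omega>\<bar>"
      using sum_lessThan_telescope[of "\<lambda>s. e s \<omega>" k] by simp
    also have "\<dots> \<le> (\<Sum>s<k. \<bar>e (Suc s) \<omega> - e s \<omega>\<bar>)" by (rule sum_abs)
    also have "\<dots> \<le> (\<Sum>s<k. C\<^sub>0 * L * (\<rho> ^ (k - s - 1) * Z s \<omega>))"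
      using step by (intro sum_mono) auto
    also have "\<dots> = C\<^sub>0 * L * (\<Sum>s<k. \<rho> ^ (k - s - 1) * Z s \<omega>)"
      by (simp add: sum_distrib_left)
    also have "(\<Sum>s<k. \<rho> ^ (k - s - 1) * Z s \<omega>) = (\<Sum>s=1..k - 1. \<rho> ^ (k - s - 1) * Z s \<omega>)"
      using assms Z0 by (intro sum.mono_neutral_right) (auto simp: not_le)
    finally show "\<bar>real_cond_exp M (H 0) (\<lambda>\<omega>. f (W k \<omega>)) \<omega>
          - (\<integral>y. f y \<partial>kernel_pow S (P (\<theta> 0 \<omega>)) k (W 0 \<omega>))\<bar>
        \<le> C\<^sub>0 * L * (\<Sum>s=1..k - 1. \<rho> ^ (k - s - 1) *
            real_cond_exp M (H 0) (\<lambda>\<omega>. U 1 (W s \<omega>) * norm (\<theta> s \<omega> - \<theta> 0 \<omega>)) \<omega>)"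
      unfolding last first Z_def by (simp add: evolve_def)
  qed
qed

end

section \<open>The error bound\<close>

theorem lemma1:
  fixes M :: "'o measure"
    and \<Theta> :: "'t::euclidean_space set"
    and \<W> :: "'w::euclidean_space set"
    and S :: "'w measure"
    and F :: "'t \<Rightarrow> 'w \<Rightarrow> 't"
    and P :: "'t \<Rightarrow> 'w \<Rightarrow> 'w measure"
    and \<alpha> :: "nat \<Rightarrow> real"
    and \<theta> :: "nat \<Rightarrow> 'o \<Rightarrow> 't"
    and W :: "nat \<Rightarrow> 'o \<Rightarrow> 'w"
    and \<rho> :: real
    and f :: "'w \<Rightarrow> real"
  assumes "\<W> \<in> sets borel"
    and S_eq: "S = restrict_space borel \<W>"
    and "case_prod F \<in> borel_measurable (restrict_space borel (\<Theta> \<times> \<W>))"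
    and "case_prod P \<in> restrict_space borel (\<Theta> \<times> \<W>) \<rightarrow>\<^sub>M prob_algebra S"
    and "prob_space M"
    and "adaptive_markov_chain M \<Theta> S F P \<alpha> \<theta> W"
    and "\<Theta> \<noteq> {}" "compact \<Theta>" "convex \<Theta>"
    and "uniform_ergodicity \<Theta> S P"
    and "(\<integral>\<^sup>+\<omega>. ennreal (U 2 (W 0 \<omega>)) \<partial>M) < \<infinity>"
    and "kernel_continuity \<Theta> S P"
    and "ergodicity_rate \<Theta> S P \<rho>"
    and "f \<in> borel_measurable S"
    and "\<And>w. w \<in> \<W> \<Longrightarrow> \<bar>f w\<bar> \<le> U 1 w"
  shows "\<exists>C>0. \<forall>k\<ge>1. AE \<omega> in M.
    \<bar>real_cond_exp M (history M \<theta> W 0) (\<lambda>\<omega>'. f (W k \<omega>')) \<omega>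
        - (\<integral>y. f y \<partial>kernel_pow S (P (\<theta> 0 \<omega>)) k (W 0 \<omega>))\<bar>
      \<le> C * (\<Sum>s=1..k - 1. \<rho> ^ (k - s - 1) *
          real_cond_exp M (history M \<theta> W 0)
            (\<lambda>\<omega>'. U 1 (W s \<omega>') * norm (\<theta> s \<omega>' - \<theta> 0 \<omega>')) \<omega>)"
proof -
  have space_S: "space S = \<W>" by (simp add: S_eq space_restrict_space)
  have chain: "\<theta> k \<in> M \<rightarrow>\<^sub>M restrict_space borel \<Theta>" "W k \<in> M \<rightarrow>\<^sub>M S" for k
    using assms(6) by (auto simp: adaptive_markov_chain_def)
  have transition: "AE \<omega> in M.
        real_cond_exp M (history M \<theta> W k) (indicator (W (Suc k) -` E \<inter> space M)) \<omega>
          = measure (P (\<theta> k \<omega>) (W k \<omega>)) E" if "E \<in> sets S" for k E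
    using assms(6) that unfolding adaptive_markov_chain_def by blast
  have pair_space: "(\<lambda>z. z) \<in> restrict_space borel \<Theta> \<Otimes>\<^sub>M S \<rightarrow>\<^sub>M restrict_space borel (\<Theta> \<times> \<W>)"
  proof (rule measurable_restrict_space2)
    have "fst \<in> restrict_space borel \<Theta> \<Otimes>\<^sub>M S \<rightarrow>\<^sub>M borel" "snd \<in> restrict_space borel \<Theta> \<Otimes>\<^sub>M S \<rightarrow>\<^sub>M borel"
      unfolding S_eq using measurable_compose[OF measurable_fst measurable_restrict_space1[OF measurable_ident]]
        measurable_compose[OF measurable_snd measurable_restrict_space1[OF measurable_ident]]
      by (simp_all add: id_def)
    from borel_measurable_Pair[OF this]
    show "(\<lambda>z. z) \<in> borel_measurable (restrict_space borel \<Theta> \<Otimes>\<^sub>M S)" by simp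
  qed (simp add: space_pair_measure space_restrict_space space_S)
  have "\<exists>W\<^sub>0 b lam. (\<forall>t\<in>\<Theta>. \<forall>w\<in>space S.
        (\<integral>\<^sup>+y. ennreal (U 2 y) \<partial>P t w) \<le> ennreal (lam * U 2 w + b * indicator W\<^sub>0 w)) \<and>
      W\<^sub>0 \<in> sets S \<and> W\<^sub>0 \<noteq> {} \<and> 0 \<le> lam \<and> lam < 1 \<and> 0 \<le> b"
    using assms(10) unfolding uniform_ergodicity_def
    by (elim conjE exE, intro exI conjI) assumption+
  then obtain W\<^sub>0 b lam where W\<^sub>0: "W\<^sub>0 \<in> sets S" "W\<^sub>0 \<noteq> {}"
    and lam: "0 \<le> lam" "lam < 1" and b: "0 \<le> b"
    and drift: "\<forall>t\<in>\<Theta>. \<forall>w\<in>space S.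
      (\<integral>\<^sup>+y. ennreal (U 2 y) \<partial>P t w) \<le> ennreal (lam * U 2 w + b * indicator W\<^sub>0 w)"
    by (elim exE conjE) (rule that)
  from W\<^sub>0 obtain w\<^sub>0 where w\<^sub>0: "w\<^sub>0 \<in> space S" using sets.sets_into_space by blast
  from assms(12) obtain L where L: "0 < L"
    and continuity: "\<And>t t' w g. t \<in> \<Theta> \<Longrightarrow> t' \<in> \<Theta> \<Longrightarrow> w \<in> space S \<Longrightarrow> g \<in> borel_measurable S \<Longrightarrow>
      (\<And>y. y \<in> space S \<Longrightarrow> \<bar>g y\<bar> \<le> U 1 y) \<Longrightarrow>
      \<bar>(\<integral>y. g y \<partial>P t w) - (\<integral>y. g y \<partial>P t' w)\<bar> \<le> L * U 1 w * norm (t - t')"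
    unfolding kernel_continuity_def by blast
  from assms(13) obtain C\<^sub>0 where \<rho>: "0 < \<rho>"
    and ergodic: "\<And>t w k g. t \<in> \<Theta> \<Longrightarrow> w \<in> space S \<Longrightarrow> g \<in> borel_measurable S \<Longrightarrow>
      (\<And>y. y \<in> space S \<Longrightarrow> \<bar>g y\<bar> \<le> U 1 y) \<Longrightarrow>
      \<bar>(\<integral>y. g y \<partial>kernel_pow S (P t) k w) - (\<integral>y. g y \<partial>stationary_distribution S (P t))\<bar>
        \<le> C\<^sub>0 * \<rho> ^ k * U 1 w"
    unfolding ergodicity_rate_def by blast
  interpret M: prob_space M by fact
  \<comment> \<open>The constant of the ergodicity rate may be zero; enlarging it makes division by it possible.\<close>
  interpret ergodic_adaptive_chain \<Theta> S P b \<rho> "max C\<^sub>0 1" L w\<^sub>0 f M \<W> \<theta> W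
  proof unfold_locales
    show "case_prod P \<in> restrict_space borel \<Theta> \<Otimes>\<^sub>M S \<rightarrow>\<^sub>M prob_algebra S"
      using measurable_compose[OF pair_space assms(4)] .
    show "U p \<in> borel_measurable S" for p
      unfolding S_eq U_def by (intro measurable_restrict_space1) measurable
    show "(\<integral>\<^sup>+y. ennreal (U 2 y) \<partial>P t w) \<le> ennreal (U 2 w + b)" if "t \<in> \<Theta>" "w \<in> space S" for t w
    proof (rule order_trans[OF drift[rule_format, OF that]], rule ennreal_leI, rule add_mono)
      show "lam * U 2 w \<le> U 2 w" using lam by (intro mult_left_le_one_le) (auto simp: U_def)
      show "b * indicator W\<^sub>0 w \<le> b" using b by (auto split: split_indicator)
    qed
    show "\<bar>(\<integral>y. g y \<partial>kernel_pow S (P t) k w) - (\<integral>y. g y \<partial>stationary_distribution S (P t))\<bar>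
        \<le> max C\<^sub>0 1 * \<rho> ^ k * U 1 w"
      if "t \<in> \<Theta>" "w \<in> space S" "g \<in> borel_measurable S" "\<And>y. y \<in> space S \<Longrightarrow> \<bar>g y\<bar> \<le> U 1 y" for t w k g
    proof -
      have "C\<^sub>0 * \<rho> ^ k * U 1 w \<le> max C\<^sub>0 1 * \<rho> ^ k * U 1 w"
        using \<rho> by (intro mult_right_mono) (auto simp: U_def)
      with ergodic[OF that, of k] show ?thesis by linarith
    qed
    show "\<bar>(\<integral>y. g y \<partial>P t w) - (\<integral>y. g y \<partial>P t' w)\<bar> \<le> L * U 1 w * norm (t - t')"
      if "t \<in> \<Theta>" "t' \<in> \<Theta>" "w \<in> space S" "g \<in> borel_measurable S"
        "\<And>y. y \<in> space S \<Longrightarrow> \<bar>g y\<bar> \<le> U 1 y" for t t' w g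
      by (rule continuity[OF that])
    show "bounded \<Theta>" using assms(8) by (rule compact_imp_bounded)
    show "0 \<le> b" "w\<^sub>0 \<in> space S" "0 < \<rho>" "0 < max C\<^sub>0 1"
      using b w\<^sub>0 \<rho> by auto
    show "f \<in> borel_measurable S" by fact
    show "\<bar>f y\<bar> \<le> U 1 y" if "y \<in> space S" for y using assms(15)[of y] that by (simp only: space_S)
  qed (fact S_eq chain transition assms(11))+
  show ?thesis
  proof (intro exI conjI allI impI)
    show "0 < max C\<^sub>0 1 * L" using L by simp
  qed (rule conditional_expectation_error)
qed

end
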